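(* For every integer $n \geq 1$, $$c(K_n) = \frac{\binom{n+1}{2}!}{(2n-1)!!},$$ where the numerator is the factorial of the binomial coefficient $\binom{n+1}{2}$ and $(2n-1)!! := (2n-1)(2n-3)\cdots 3\cdot 1$.
   Context: Graphs are finite, simple and undirected. The elements of a graph $G=(V,E)$ are the members of $V \cup E$. A construction sequence (c-sequence) for $G$ is a listing of all the elements of $G$, without repetitions, such that each edge appears after both of its endpoints. The construction number $c(G)$ is the number of distinct construction sequences for $G$. $K_n$ is the complete graph on $n$ vertices. *)

theory Defs
  imports Complex_Main
begin

type_synonym 'a graph = "'a set \<times> 'a set set"

abbreviation verts :: "'a graph \<Rightarrow> 'a set" where
  "verts G \<equiv> fst G"

abbreviation edges :: "'a graph \<Rightarrow> 'a set set" where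
  "edges G \<equiv> snd G"

definition simple_graph :: "'a graph \<Rightarrow> bool" where
  "simple_graph G \<longleftrightarrow> finite (verts G) \<and> (\<forall>e\<in>edges G. e \<subseteq> verts G \<and> card e = 2)"

definition complete_graph :: "'a graph \<Rightarrow> bool" where
  "complete_graph G \<longleftrightarrow> simple_graph G \<and>
     (\<forall>u\<in>verts G. \<forall>v\<in>verts G. u \<noteq> v \<longrightarrow> {u, v} \<in> edges G)"

(* Tagging makes vertices and edges elements of a common type. *)
datatype 'a elem = Vertex 'a | Edge "'a set"

definition elements :: "'a graph \<Rightarrow> 'a elem set" where
  "elements G = Vertex ` verts G \<union> Edge ` edges G"

definition is_cseq :: "'a graph \<Rightarrow> 'a elem list \<Rightarrow> bool" where
  "is_cseq G xs \<longleftrightarrow> distinct xs \<and> set xs = elements G \<and>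
     (\<forall>e\<in>edges G. \<forall>v\<in>e. \<exists>i j. i < j \<and> j < length xs \<and> xs ! i = Vertex v \<and> xs ! j = Edge e)"

definition construction_number :: "'a graph \<Rightarrow> nat" where
  "construction_number G = card {xs. is_cseq G xs}"

fun double_fact :: "nat \<Rightarrow> nat" where
  "double_fact 0 = 1"
| "double_fact (Suc 0) = 1"
| "double_fact (Suc (Suc n)) = Suc (Suc n) * double_fact n"

(* A graph has finitely many construction sequences, so the cardinality above is the true count
   and not the default value 0 that card assigns to infinite sets. *)
lemma finite_cseqs:
  assumes "simple_graph G"
  shows "finite {xs. is_cseq G xs}"
proof -
  have "edges G \<subseteq> Pow (verts G)" "finite (verts G)"
    using assms by (auto simp: simple_graph_def)
  then have "finite (elements G)"
    by (auto simp: elements_def intro: finite_subset)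
  then have "finite {xs. set xs \<subseteq> elements G \<and> length xs \<le> card (elements G)}"
    by (rule finite_lists_length_le)
  then show ?thesis
    by (rule rev_finite_subset) (auto simp: is_cseq_def dest: distinct_card)
qed

end

theory Submission
  imports Defs
begin

text \<open>
  A construction sequence is a linear extension of the incidence order on \<^term>\<open>elements K\<close>, and
  linear extensions are counted by peeling off the first element: what follows it is a linear
  extension of the rest, and it can be any element that is minimal in the whole.

  What is left of \<^term>\<open>K\<close> after some steps consists of a set \<open>U\<close> of \<open>r\<close> vertices and a set \<open>F\<close> of
  edges that contains every edge meeting \<open>U\<close>. Its minimal elements are the vertices in \<open>U\<close> and the
  \<open>m\<close> edges in \<open>F\<close> that avoid \<open>U\<close>. So the number of completions depends only on \<open>r\<close> and on the
  number \<open>T\<close> of elements left. Calling it \<open>f r T\<close>, this gives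
  \<open>f r T = r * f (r - 1) (T - 1) + m * f r (T - 1)\<close>, where
  \<open>2 * T = 2 * m + r * (2 * n + 1 - r)\<close> because exactly \<open>(n choose 2) - ((n - r) choose 2)\<close> edges
  meet \<open>U\<close>. Induction on \<open>T\<close> confirms the solution \<open>f r T = T! * 2^r * (2 * n - r)! / (2 * n)!\<close>
  (lemma \<open>card_linear_extensions_remainder\<close>): for positive \<open>r\<close> both summands share the factor
  \<open>(T - 1)! * 2^(r - 1) * (2 * n - r)! / (2 * n)!\<close>, and the remaining factors
  \<open>r * (2 * n + 1 - r)\<close> and \<open>2 * m\<close> add up to \<open>2 * T\<close>.

  At the start \<open>r = n\<close> and \<open>T = (n + 1) choose 2\<close>, and \<open>(2 * n)! = 2^n * n! * (2 * n - 1)!!\<close> turns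
  the solution into the stated quotient.

  Where the factor \<open>(2 * n)!\<close> comes from: once the order in which the vertices appear is fixed, the
  incidence constraints form a forest, since an edge then only has to wait for the later of its
  endpoints. The hook length formula for forests counts its linear extensions, and the closed form
  above is what that formula yields, summed over the vertex orders.
\<close>

section \<open>Linear extensions of a relation\<close>

definition linear_extensions :: "('b \<Rightarrow> 'b \<Rightarrow> bool) \<Rightarrow> 'b set \<Rightarrow> 'b list set" where
  "linear_extensions R B = {xs. distinct xs \<and> set xs = B \<and> sorted_wrt (\<lambda>x y. \<not> R y x) xs}"

definition minimal_elements :: "('b \<Rightarrow> 'b \<Rightarrow> bool) \<Rightarrow> 'b set \<Rightarrow> 'b set" where
  "minimal_elements R B = {x \<in> B. \<forall>y \<in> B - {x}. \<not> R y x}"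

lemma linear_extensions_empty [simp]: "linear_extensions R {} = {[]}"
  by (auto simp: linear_extensions_def)

lemma finite_linear_extensions:
  assumes "finite B"
  shows "finite (linear_extensions R B)"
  by (rule finite_subset [OF _ finite_lists_length_le [OF assms, of "card B"]])
     (auto simp: linear_extensions_def dest: distinct_card)

lemma linear_extensions_nonempty_decomp:
  assumes "B \<noteq> {}"
  shows "linear_extensions R B =
    (\<Union>x \<in> minimal_elements R B. (#) x ` linear_extensions R (B - {x}))"
proof (intro set_eqI iffI)
  fix xs
  assume xs: "xs \<in> linear_extensions R B"
  with assms obtain x ys where "xs = x # ys"
    by (cases xs) (auto simp: linear_extensions_def)
  with xs show "xs \<in> (\<Union>x \<in> minimal_elements R B. (#) x ` linear_extensions R (B - {x}))"
    by (auto simp: linear_extensions_def minimal_elements_def)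
next
  fix xs
  assume "xs \<in> (\<Union>x \<in> minimal_elements R B. (#) x ` linear_extensions R (B - {x}))"
  then show "xs \<in> linear_extensions R B"
    by (auto simp: linear_extensions_def minimal_elements_def)
qed

lemma card_linear_extensions_rec:
  assumes "finite B" "B \<noteq> {}"
  shows "card (linear_extensions R B) =
    (\<Sum>x \<in> minimal_elements R B. card (linear_extensions R (B - {x})))"
proof -
  have "card (\<Union>x \<in> minimal_elements R B. (#) x ` linear_extensions R (B - {x})) =
      (\<Sum>x \<in> minimal_elements R B. card ((#) x ` linear_extensions R (B - {x})))"
    using assms(1)
    by (intro card_UN_disjoint) (auto simp: minimal_elements_def intro: finite_linear_extensions)
  also have "\<dots> = (\<Sum>x \<in> minimal_elements R B. card (linear_extensions R (B - {x})))"
    by (intro sum.cong refl card_image) auto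
  finally show ?thesis
    using linear_extensions_nonempty_decomp [OF assms(2), of R] by simp
qed

section \<open>Construction sequences as linear extensions\<close>

definition incident :: "'a elem \<Rightarrow> 'a elem \<Rightarrow> bool" where
  "incident x y \<longleftrightarrow> (\<exists>v e. x = Vertex v \<and> y = Edge e \<and> v \<in> e)"

text \<open>
  The two notions order an edge and its endpoint in opposite ways: one exhibits positions where the
  endpoint comes first, the other forbids positions where the edge comes first. They agree because
  both elements occur, and occur only once.
\<close>

lemma cseqs_eq_linear_extensions:
  assumes "simple_graph G"
  shows "{xs. is_cseq G xs} = linear_extensions incident (elements G)"
proof (intro set_eqI iffI)
  fix xs
  assume "xs \<in> {xs. is_cseq G xs}"
  then have d: "distinct xs" and s: "set xs = elements G"
    and before: "\<And>e v. e \<in> edges G \<Longrightarrow> v \<in> e \<Longrightarrow>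
      \<exists>i j. i < j \<and> j < length xs \<and> xs ! i = Vertex v \<and> xs ! j = Edge e"
    by (auto simp: is_cseq_def)
  have "\<not> incident (xs ! j) (xs ! i)" if ij: "i < j" "j < length xs" for i j
  proof
    assume "incident (xs ! j) (xs ! i)"
    then obtain v e where ve: "xs ! j = Vertex v" "xs ! i = Edge e" "v \<in> e"
      by (auto simp: incident_def)
    have "xs ! i \<in> elements G"
      using s ij by (metis less_trans nth_mem)
    then have "e \<in> edges G"
      using ve by (auto simp: elements_def)
    then obtain i' j' where "i' < j'" "j' < length xs" "xs ! i' = Vertex v" "xs ! j' = Edge e"
      using before ve by blast
    moreover from this have "i' = j" "j' = i"
      using d ij ve by (metis less_trans nth_eq_iff_index_eq)+
    ultimately show False
      using ij by simp
  qed
  then show "xs \<in> linear_extensions incident (elements G)"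
    using d s by (auto simp: linear_extensions_def sorted_wrt_iff_nth_less)
next
  fix xs
  assume "xs \<in> linear_extensions incident (elements G)"
  then have d: "distinct xs" and s: "set xs = elements G"
    and sorted: "\<And>i j. i < j \<Longrightarrow> j < length xs \<Longrightarrow> \<not> incident (xs ! j) (xs ! i)"
    by (auto simp: linear_extensions_def sorted_wrt_iff_nth_less)
  have "\<exists>i j. i < j \<and> j < length xs \<and> xs ! i = Vertex v \<and> xs ! j = Edge e"
    if "e \<in> edges G" "v \<in> e" for e v
  proof -
    have "Vertex v \<in> set xs" "Edge e \<in> set xs"
      using assms that s by (auto simp: elements_def simple_graph_def)
    then obtain i j where i: "i < length xs" "xs ! i = Vertex v"
      and j: "j < length xs" "xs ! j = Edge e"
      by (auto simp: in_set_conv_nth)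
    have "\<not> j < i"
      using sorted i j that by (auto simp: incident_def)
    moreover have "i \<noteq> j"
      using i j by auto
    ultimately have "i < j"
      by simp
    with i j show ?thesis
      by blast
  qed
  with d s show "xs \<in> {xs. is_cseq G xs}"
    by (simp add: is_cseq_def)
qed

section \<open>What is left of a complete graph\<close>

lemma complete_graph_edges:
  assumes "complete_graph K"
  shows "edges K = {e. e \<subseteq> verts K \<and> card e = 2}"
  using assms by (auto simp: complete_graph_def simple_graph_def card_2_iff)

lemma two_times_choose_two: "2 * (k choose 2) = k * (k - 1)"
  by (cases k) (simp_all add: choose_two)

lemma minimal_elements_remainder:
  "minimal_elements incident (Vertex ` U \<union> Edge ` F) = Vertex ` U \<union> Edge ` {e \<in> F. e \<inter> U = {}}"
proof (rule set_eqI)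
  fix x
  show "x \<in> minimal_elements incident (Vertex ` U \<union> Edge ` F) \<longleftrightarrow>
      x \<in> Vertex ` U \<union> Edge ` {e \<in> F. e \<inter> U = {}}"
    by (cases x) (simp_all add: minimal_elements_def incident_def ball_Un image_iff, blast+)
qed

text \<open>
  Since the edges of \<^term>\<open>K\<close> that avoid \<open>U\<close> are the 2-subsets of \<^term>\<open>verts K - U\<close>, the number of
  elements that are bound to wait for \<open>U\<close>, together with \<open>U\<close> itself, is determined by the size of \<open>U\<close>.
\<close>

lemma card_free_edges:
  assumes K: "complete_graph K" and n: "card (verts K) = n"
    and U: "U \<subseteq> verts K" and F: "F \<subseteq> edges K"
    and meet: "\<And>e. e \<in> edges K \<Longrightarrow> e \<inter> U \<noteq> {} \<Longrightarrow> e \<in> F"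
  shows "2 * (card U + card F) =
    card U * (2 * n + 1 - card U) + 2 * card {e \<in> F. e \<inter> U = {}}"
proof -
  have finV: "finite (verts K)"
    using K by (simp add: complete_graph_def simple_graph_def)
  then have finE: "finite (edges K)"
    by (simp add: complete_graph_edges [OF K])
  have finF: "finite F"
    using F finE by (rule finite_subset)
  let ?waiting = "{e \<in> edges K. e \<inter> U \<noteq> {}}" and ?avoiding = "{e. e \<subseteq> verts K - U \<and> card e = 2}"
  have "edges K = ?waiting \<union> ?avoiding"
    by (auto simp: complete_graph_edges [OF K])
  moreover have "card (?waiting \<union> ?avoiding) = card ?waiting + card ?avoiding"
    using finV finE by (intro card_Un_disjoint) auto
  ultimately have "card (edges K) = card ?waiting + card ?avoiding"
    by (rule trans [OF arg_cong [where f = card]])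
  then have waiting: "n choose 2 = card ?waiting + ((n - card U) choose 2)"
    using finV n U
    by (simp add: complete_graph_edges [OF K] n_subsets card_Diff_subset finite_subset)
  have "F = ?waiting \<union> {e \<in> F. e \<inter> U = {}}"
    using F meet by blast
  moreover have "card (?waiting \<union> {e \<in> F. e \<inter> U = {}}) =
      card ?waiting + card {e \<in> F. e \<inter> U = {}}"
    using finE finF by (intro card_Un_disjoint) auto
  ultimately have cF: "card F = card ?waiting + card {e \<in> F. e \<inter> U = {}}"
    by (rule trans [OF arg_cong [where f = card]])
  \<comment> \<open>In terms of \<open>card U\<close> and \<open>s\<close> every subtraction except the predecessors disappears, so that
    the count becomes a polynomial identity.\<close>
  obtain s where s: "n = card U + s"
    using card_mono [OF finV U] n le_Suc_ex by blast
  have "2 * card ?waiting + s * (s - 1) = n * (n - 1)"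
    using waiting two_times_choose_two [of n] two_times_choose_two [of s] s by simp
  then have "2 * (card U + card ?waiting) = card U * (2 * n + 1 - card U)"
    unfolding s by (cases s; cases "card U") (auto simp: algebra_simps)
  with cF show ?thesis
    by (simp add: algebra_simps)
qed

text \<open>
  Multiplying by \<^term>\<open>fact (2 * n) :: nat\<close> keeps the closed form in the natural numbers. The
  edges in \<open>F\<close> that avoid \<open>U\<close> are arbitrary, which is what makes the induction go through: placing
  a vertex releases some edges, and placing a released edge only shrinks \<open>F\<close>.
\<close>

lemma card_linear_extensions_remainder:
  assumes K: "complete_graph K" and n: "card (verts K) = n"
    and "U \<subseteq> verts K" "F \<subseteq> edges K"
    and "\<And>e. e \<in> edges K \<Longrightarrow> e \<inter> U \<noteq> {} \<Longrightarrow> e \<in> F"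
    and "card U + card F = T"
  shows "card (linear_extensions incident (Vertex ` U \<union> Edge ` F)) * fact (2 * n) =
    fact T * 2 ^ card U * fact (2 * n - card U)"
  using assms(3-)
proof (induction T arbitrary: U F)
  case (0 U F)
  have finV: "finite (verts K)"
    using K by (simp add: complete_graph_def simple_graph_def)
  then have "finite (edges K)"
    by (simp add: complete_graph_edges [OF K])
  with finV 0 have "U = {}" "F = {}"
    by (auto dest: finite_subset)
  then show ?case
    by simp
next
  case (Suc T U F)
  have finV: "finite (verts K)"
    using K by (simp add: complete_graph_def simple_graph_def)
  then have "finite (edges K)"
    by (simp add: complete_graph_edges [OF K])
  with finV Suc.prems have finU: "finite U" and finF: "finite F"
    by (auto dest: finite_subset)
  let ?B = "Vertex ` U \<union> Edge ` F"
  let ?L = "\<lambda>A. card (linear_extensions incident A)"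
  let ?free = "{e \<in> F. e \<inter> U = {}}"
  let ?r = "card U"
  have "?B \<noteq> {}"
    using Suc.prems by auto
  then have "?L ?B = (\<Sum>x \<in> Vertex ` U \<union> Edge ` ?free. ?L (?B - {x}))"
    using finU finF by (subst card_linear_extensions_rec) (auto simp: minimal_elements_remainder)
  also have "\<dots> = (\<Sum>x \<in> Vertex ` U. ?L (?B - {x})) + (\<Sum>x \<in> Edge ` ?free. ?L (?B - {x}))"
    using finU finF by (intro sum.union_disjoint) auto
  also have "\<dots> = (\<Sum>v \<in> U. ?L (?B - {Vertex v})) + (\<Sum>e \<in> ?free. ?L (?B - {Edge e}))"
    by (simp add: sum.reindex inj_on_def)
  finally have rec: "?L ?B * fact (2 * n) =
      (\<Sum>v \<in> U. ?L (?B - {Vertex v}) * fact (2 * n)) +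
      (\<Sum>e \<in> ?free. ?L (?B - {Edge e}) * fact (2 * n))"
    by (simp add: distrib_right sum_distrib_right)
  have vertex_first: "?L (?B - {Vertex v}) * fact (2 * n) =
      fact T * 2 ^ (?r - 1) * fact (2 * n - (?r - 1))" if v: "v \<in> U" for v
  proof -
    have "?B - {Vertex v} = Vertex ` (U - {v}) \<union> Edge ` F"
      by auto
    moreover have "card (U - {v}) = ?r - 1" "?r > 0"
      using v finU by (auto simp: card_gt_0_iff)
    moreover have "?L (Vertex ` (U - {v}) \<union> Edge ` F) * fact (2 * n) =
        fact T * 2 ^ card (U - {v}) * fact (2 * n - card (U - {v}))"
      using Suc.prems \<open>card (U - {v}) = ?r - 1\<close> \<open>?r > 0\<close> by (intro Suc.IH) auto
    ultimately show ?thesis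
      by simp
  qed
  have edge_first: "?L (?B - {Edge e}) * fact (2 * n) =
      fact T * 2 ^ ?r * fact (2 * n - ?r)" if e: "e \<in> ?free" for e
  proof -
    have "?B - {Edge e} = Vertex ` U \<union> Edge ` (F - {e})"
      by auto
    moreover have "card (F - {e}) = card F - 1" "card F > 0"
      using e finF by (auto simp: card_gt_0_iff)
    moreover have "?L (Vertex ` U \<union> Edge ` (F - {e})) * fact (2 * n) =
        fact T * 2 ^ ?r * fact (2 * n - ?r)"
      using Suc.prems e \<open>card (F - {e}) = card F - 1\<close> \<open>card F > 0\<close> by (intro Suc.IH) auto
    ultimately show ?thesis
      by simp
  qed
  have total: "?L ?B * fact (2 * n) =
      ?r * (fact T * 2 ^ (?r - 1) * fact (2 * n - (?r - 1))) +
      card ?free * (fact T * 2 ^ ?r * fact (2 * n - ?r))"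
    unfolding rec using vertex_first edge_first by simp
  have balance: "2 * Suc T = ?r * (2 * n + 1 - ?r) + 2 * card ?free"
    using card_free_edges [OF K n, of U F] Suc.prems by simp
  show ?case
  proof (cases ?r)
    case 0
    then have "card ?free = Suc T"
      using balance by simp
    with 0 show ?thesis
      using total by (simp add: algebra_simps)
  next
    case (Suc r)
    have "?r \<le> n"
      using card_mono [OF finV] Suc.prems n by blast
    then have "2 * n - r = Suc (2 * n - ?r)" "2 * n + 1 - ?r = Suc (2 * n - ?r)"
      using Suc by auto
    then have "?L ?B * fact (2 * n) = (?r * (2 * n + 1 - ?r) + 2 * card ?free) *
        (fact T * 2 ^ r * fact (2 * n - ?r))"
      using total Suc by (simp add: algebra_simps)
    also have "\<dots> = 2 * Suc T * (fact T * 2 ^ r * fact (2 * n - ?r))"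
      by (simp only: balance)
    also have "\<dots> = fact (Suc T) * 2 ^ ?r * fact (2 * n - ?r)"
      using Suc by (simp add: algebra_simps)
    finally show ?thesis .
  qed
qed

section \<open>The construction number of a complete graph\<close>

lemma fact_double_eq_double_fact:
  "fact (2 * n) = 2 ^ n * fact n * double_fact (2 * n - 1)"
proof (induction n)
  case (Suc n)
  have "double_fact (2 * Suc n - 1) = (2 * n + 1) * double_fact (2 * n - 1)"
    by (cases n) auto
  with Suc show ?case
    by (simp add: algebra_simps)
qed simp

theorem theorem5:
  fixes K :: "'a graph" and n :: nat
  assumes "n \<ge> 1"
    and "complete_graph K"
    and "card (verts K) = n"
  shows "real (construction_number K) = fact ((n + 1) choose 2) / real (double_fact (2 * n - 1))"
proof -
  have "finite (verts K)" "simple_graph K"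
    using assms by (auto simp: complete_graph_def simple_graph_def)
  then have "card (verts K) + card (edges K) = (n + 1) choose 2"
    using assms by (simp add: complete_graph_edges n_subsets numeral_2_eq_2)
  then have "construction_number K * fact (2 * n) = fact ((n + 1) choose 2) * 2 ^ n * fact n"
    using card_linear_extensions_remainder [of K n "verts K" "edges K"] assms \<open>simple_graph K\<close>
    by (simp add: construction_number_def cseqs_eq_linear_extensions elements_def)
  then have "(2 ^ n * fact n) * (construction_number K * double_fact (2 * n - 1)) =
      (2 ^ n * fact n) * fact ((n + 1) choose 2)"
    unfolding fact_double_eq_double_fact by (simp only: mult_ac)
  then have count: "construction_number K * double_fact (2 * n - 1) = fact ((n + 1) choose 2)"
    by simp
  then have "double_fact (2 * n - 1) \<noteq> 0"
    by (intro notI) simp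
  moreover have "real (construction_number K) * real (double_fact (2 * n - 1)) =
      fact ((n + 1) choose 2)"
    using arg_cong [OF count, of real] by (simp only: of_nat_mult of_nat_fact)
  ultimately show ?thesis
    by (intro iffD2 [OF nonzero_eq_divide_eq]) simp_all
qed

end
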